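(* Let $\mu$ be a positive rational number. The real vector space $(\Sigma_\mu,\boxplus)$ with the inner product $(\langle A\rangle\mid\langle B\rangle):=(A\mid B)_W$, $A\in\langle A\rangle$, $B\in\langle B\rangle$, is an inner product space.
   Context: Matrices are over $\mathbb{R}$; $\otimes$ is the Kronecker product. Write $\mu=\mu_y/\mu_x$ with $\mu_y,\mu_x$ coprime positive integers, $\mathcal{M}_\mu^i:=\mathcal{M}_{i\mu_y\times i\mu_x}$, $\mathcal{M}_\mu:=\bigcup_{i\ge1}\mathcal{M}_\mu^i$. $A\sim B$ means $A\otimes I_s=B\otimes I_t$ for some positive integers $s,t$; $\Sigma_\mu:=\mathcal{M}_\mu/\!\sim$, with classes $\langle A\rangle$. For $A\in\mathcal{M}_\mu^\alpha$, $B\in\mathcal{M}_\mu^\beta$ and $t=\mathrm{lcm}(\alpha,\beta)$: $A\boxplus B:=A\otimes I_{t/\alpha}+B\otimes I_{t/\beta}$, and $\Sigma_\mu$ is a vector space under $\langle A\rangle\boxplus\langle B\rangle:=\langle A\boxplus B\rangle$ and $a\langle A\rangle:=\langle aA\rangle$. The weighted inner product is $(A\mid B)_W:=\frac1t\,(A\otimes I_{t/\alpha}\mid B\otimes I_{t/\beta})_F$, where $(C\mid D)_F=\sum_{i,j}c_{i,j}d_{i,j}$ is the Frobenius inner product; the value depends only on the classes of $A$ and $B$. *)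

theory Defs
  imports Jordan_Normal_Form.VS_Connect
begin

definition kron :: "real mat \<Rightarrow> real mat \<Rightarrow> real mat" where
  "kron A B = mat (dim_row A * dim_row B) (dim_col A * dim_col B)
     (\<lambda>(i, j). A $$ (i div dim_row B, j div dim_col B) * B $$ (i mod dim_row B, j mod dim_col B))"

definition frob_inner :: "real mat \<Rightarrow> real mat \<Rightarrow> real" where
  "frob_inner C D = (\<Sum>i<dim_row C. \<Sum>j<dim_col C. C $$ (i, j) * D $$ (i, j))"

text \<open>For a positive rational, \<^const>\<open>quotient_of\<close> yields the reduced numerator and
  the (positive) denominator.\<close>

definition ratio_y :: "rat \<Rightarrow> nat" where
  "ratio_y \<mu> = nat (fst (quotient_of \<mu>))"

definition ratio_x :: "rat \<Rightarrow> nat" where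
  "ratio_x \<mu> = nat (snd (quotient_of \<mu>))"

definition mat_level :: "rat \<Rightarrow> nat \<Rightarrow> real mat set" where
  "mat_level \<mu> i = carrier_mat (i * ratio_y \<mu>) (i * ratio_x \<mu>)"

definition mats :: "rat \<Rightarrow> real mat set" where
  "mats \<mu> = (\<Union>i\<in>{1..}. mat_level \<mu> i)"

definition level :: "rat \<Rightarrow> real mat \<Rightarrow> nat" where
  "level \<mu> A = (THE i. i \<ge> 1 \<and> A \<in> mat_level \<mu> i)"

definition mat_rel :: "rat \<Rightarrow> (real mat \<times> real mat) set" where
  "mat_rel \<mu> = {(A, B). A \<in> mats \<mu> \<and> B \<in> mats \<mu> \<and>
     (\<exists>s t. s \<ge> 1 \<and> t \<ge> 1 \<and> kron A (1\<^sub>m s) = kron B (1\<^sub>m t))}"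

definition mat_class :: "rat \<Rightarrow> real mat \<Rightarrow> real mat set" where
  "mat_class \<mu> A = mat_rel \<mu> `` {A}"

definition mat_boxplus :: "rat \<Rightarrow> real mat \<Rightarrow> real mat \<Rightarrow> real mat" where
  "mat_boxplus \<mu> A B =
     (let \<alpha> = level \<mu> A; \<beta> = level \<mu> B; t = lcm \<alpha> \<beta>
      in kron A (1\<^sub>m (t div \<alpha>)) + kron B (1\<^sub>m (t div \<beta>)))"

definition weighted_inner :: "rat \<Rightarrow> real mat \<Rightarrow> real mat \<Rightarrow> real" where
  "weighted_inner \<mu> A B =
     (let \<alpha> = level \<mu> A; \<beta> = level \<mu> B; t = lcm \<alpha> \<beta>
      in frob_inner (kron A (1\<^sub>m (t div \<alpha>))) (kron B (1\<^sub>m (t div \<beta>))) / real t)"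

text \<open>The operations on classes range over all representatives. The two unions are equivalence
  classes exactly when the result is independent of the representatives, so closure of the
  carrier under them includes their well-definedness. The fields \<open>mult\<close> and \<open>one\<close> of the module
  record play no role in a vector space.\<close>

definition Sigma_space :: "rat \<Rightarrow> (real, real mat set) module" where
  "Sigma_space \<mu> = \<lparr>
     carrier = mats \<mu> // mat_rel \<mu>,
     mult = undefined,
     one = undefined,
     zero = mat_class \<mu> (0\<^sub>m (ratio_y \<mu>) (ratio_x \<mu>)),
     add = (\<lambda>X Y. \<Union>A\<in>X. \<Union>B\<in>Y. mat_class \<mu> (mat_boxplus \<mu> A B)),
     smult = (\<lambda>a X. \<Union>A\<in>X. mat_class \<mu> (a \<cdot>\<^sub>m A))\<rparr>"

definition Sigma_inner :: "rat \<Rightarrow> real mat set \<Rightarrow> real mat set \<Rightarrow> real" where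
  "Sigma_inner \<mu> X Y = the_elem (\<Union>A\<in>X. \<Union>B\<in>Y. {weighted_inner \<mu> A B})"

locale real_inner_product_space = vectorspace "class_ring :: real ring" V
  for V :: "(real, 'v, 'm) module_scheme" (structure) +
  fixes ip :: "'v \<Rightarrow> 'v \<Rightarrow> real"
  assumes ip_commute: "\<lbrakk>x \<in> carrier V; y \<in> carrier V\<rbrakk> \<Longrightarrow> ip x y = ip y x"
    and ip_add_left:
      "\<lbrakk>x \<in> carrier V; y \<in> carrier V; z \<in> carrier V\<rbrakk> \<Longrightarrow> ip (x \<oplus>\<^bsub>V\<^esub> y) z = ip x z + ip y z"
    and ip_smult_left:
      "\<lbrakk>x \<in> carrier V; y \<in> carrier V\<rbrakk> \<Longrightarrow> ip (a \<odot>\<^bsub>V\<^esub> x) y = a * ip x y"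
    and ip_ge_zero: "x \<in> carrier V \<Longrightarrow> 0 \<le> ip x x"
    and ip_eq_zero_iff: "x \<in> carrier V \<Longrightarrow> ip x x = 0 \<longleftrightarrow> x = \<zero>\<^bsub>V\<^esub>"

end

theory Submission
  imports Defs
begin

text \<open>Any finitely many classes have representatives in one common level \<open>N\<close>, obtained by
  tensoring with identity matrices. Since \<open>A \<mapsto> A \<otimes> I\<^sub>s\<close> is linear, injective and scales the
  Frobenius inner product by \<open>s\<close>, the classes meeting level \<open>N\<close> form a copy of the matrix space
  of that level with inner product \<open>(\<cdot>|\<cdot>)\<^sub>F / N\<close>, and every axiom reduces to the corresponding
  one for matrices of a fixed size.\<close>

subsection \<open>Kronecker products with identity matrices\<close>

lemma dim_kron [simp]:
  "dim_row (kron A B) = dim_row A * dim_row B" "dim_col (kron A B) = dim_col A * dim_col B"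
  by (simp_all add: kron_def)

text \<open>Quotients by \<open>s\<close> locate the block, remainders the position inside it. The
  facts below about tensoring with an identity are read off from this block form.\<close>

lemma index_kron_one:
  assumes "i < dim_row A * s" "j < dim_col A * s"
  shows "kron A (1\<^sub>m s) $$ (i, j) = (if i mod s = j mod s then A $$ (i div s, j div s) else 0)"
proof -
  have "s > 0" using assms by (cases s) auto
  then show ?thesis using assms by (simp add: kron_def)
qed

lemma div_less_dim: "i < m * s \<Longrightarrow> i div s < m" for i m s :: nat
  by (simp add: less_mult_imp_div_less)

lemma kron_one_one: "kron A (1\<^sub>m 1) = A"
  by (rule eq_matI) (auto simp: index_kron_one)

text \<open>Associativity, together with the fact that a product of identities is an identity.
  Entrywise, a residue modulo \<open>s * t\<close> consists of two digits: the remainder modulo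
  \<open>t\<close>, and the quotient by \<open>t\<close> reduced modulo \<open>s\<close>.\<close>

lemma kron_one_kron_one: "kron (kron A (1\<^sub>m s)) (1\<^sub>m t) = kron A (1\<^sub>m (s * t))"
proof (rule eq_matI, goal_cases)
  case (1 i j)
  then have i: "i < dim_row A * s * t" and j: "j < dim_col A * s * t"
    by (simp_all add: mult.assoc)
  have split: "x mod (s * t) = t * (x div t mod s) + x mod t" for x
    by (metis mod_mult2_eq mult.commute)
  have "t > 0" using i by (cases t) auto
  \<comment> \<open>Uniqueness of the digits in \<open>split\<close>: reduction modulo
    \<open>t\<close> recovers the lower one, division by \<open>t\<close> the upper one.\<close>
  have eq_iff: "i mod (s * t) = j mod (s * t) \<longleftrightarrow> i mod t = j mod t \<and> i div t mod s = j div t mod s"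
  proof
    assume "i mod (s * t) = j mod (s * t)"
    then show "i mod t = j mod t \<and> i div t mod s = j div t mod s"
      using \<open>t > 0\<close> unfolding split
      by (metis add.commute div_mult_self2 div_less mod_less_divisor mod_mod_trivial
          mod_mult_self2 neq0_conv add_0)
  qed (simp add: split)
  have dd: "x div (s * t) = x div t div s" for x
    by (metis div_mult2_eq mult.commute)
  show ?case
    using i j div_less_dim[OF i] div_less_dim[OF j]
    by (simp add: index_kron_one eq_iff dd mult.assoc)
qed (simp_all add: mult.assoc)

lemma kron_add_one:
  assumes "A \<in> carrier_mat m n" "B \<in> carrier_mat m n"
  shows "kron (A + B) (1\<^sub>m s) = kron A (1\<^sub>m s) + kron B (1\<^sub>m s)"
  using assms by (intro eq_matI) (auto simp: index_kron_one div_less_dim)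

lemma kron_smult_one: "kron (a \<cdot>\<^sub>m A) (1\<^sub>m s) = a \<cdot>\<^sub>m kron A (1\<^sub>m s)"
  by (rule eq_matI) (auto simp: index_kron_one div_less_dim)

lemma kron_zero_one: "kron (0\<^sub>m m n) (1\<^sub>m s) = 0\<^sub>m (m * s) (n * s)"
  by (rule eq_matI) (auto simp: index_kron_one div_less_dim)

text \<open>Each entry of the factor can be read back at the upper left corner of its block, and the
  dimensions agree by cancelling \<open>s\<close>.\<close>

lemma kron_one_inject:
  assumes "kron A (1\<^sub>m s) = kron B (1\<^sub>m s)" "s > 0"
  shows "A = B"
proof (rule eq_matI)
  from assms show dims: "dim_row A = dim_row B" "dim_col A = dim_col B"
    by (metis dim_kron index_one_mat(2,3) mult_cancel2 neq0_conv)+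
  fix i j assume "i < dim_row B" "j < dim_col B"
  then have "kron A (1\<^sub>m s) $$ (i * s, j * s) = A $$ (i, j)"
    "kron B (1\<^sub>m s) $$ (i * s, j * s) = B $$ (i, j)"
    using assms(2) dims by (simp_all add: index_kron_one)
  with assms(1) show "A $$ (i, j) = B $$ (i, j)" by simp
qed

text \<open>Reindexing along \<open>i = a * s + b\<close> with \<open>b < s\<close>: the range is
  cut into \<open>m\<close> consecutive blocks of length \<open>s\<close>.\<close>

lemma sum_div_mod:
  fixes f :: "nat \<Rightarrow> nat \<Rightarrow> 'a :: comm_monoid_add"
  shows "(\<Sum>i<m * s. f (i div s) (i mod s)) = (\<Sum>a<m. \<Sum>b<s. f a b)"
proof -
  have "(\<Sum>i<m * s. f (i div s) (i mod s)) =
      (\<Sum>a<m. \<Sum>i\<in>{a * s..<a * s + s}. f (i div s) (i mod s))"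
    by (rule sum.nat_group[symmetric])
  also have "\<dots> = (\<Sum>a<m. \<Sum>b<s. f a b)"
  proof (rule sum.cong[OF refl])
    fix a
    have "(\<Sum>i\<in>{a * s..<a * s + s}. f (i div s) (i mod s)) =
        (\<Sum>b<s. f ((b + a * s) div s) ((b + a * s) mod s))"
      using sum.shift_bounds_nat_ivl[of "\<lambda>i. f (i div s) (i mod s)" 0 "a * s" s]
      by (simp add: add.commute lessThan_atLeast0)
    also have "\<dots> = (\<Sum>b<s. f a b)" by (rule sum.cong) auto
    finally show "(\<Sum>i\<in>{a * s..<a * s + s}. f (i div s) (i mod s)) = (\<Sum>b<s. f a b)" .
  qed
  finally show ?thesis .
qed

text \<open>Only the diagonals of the blocks contribute, and each product of entries occurs there
  \<open>s\<close> times. The division by \<open>t\<close> in \<open>weighted_inner\<close>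
  compensates this factor.\<close>

lemma frob_inner_kron_one:
  assumes "A \<in> carrier_mat m n" "B \<in> carrier_mat m n"
  shows "frob_inner (kron A (1\<^sub>m s)) (kron B (1\<^sub>m s)) = real s * frob_inner A B"
proof -
  let ?c = "\<lambda>a c. A $$ (a, c) * B $$ (a, c)"
  have "frob_inner (kron A (1\<^sub>m s)) (kron B (1\<^sub>m s)) =
      (\<Sum>i<m * s. \<Sum>j<n * s. if i mod s = j mod s then ?c (i div s) (j div s) else 0)"
    unfolding frob_inner_def using assms by (intro sum.cong) (auto simp: index_kron_one)
  also have "\<dots> = (\<Sum>a<m. \<Sum>b<s. \<Sum>c<n. \<Sum>d<s. if b = d then ?c a c else 0)"
    \<comment> \<open>The row index is split first, then the column index.\<close>
    by (subst sum_div_mod[symmetric], rule sum.cong[OF refl], subst sum_div_mod[symmetric]) simp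
  also have "\<dots> = (\<Sum>a<m. \<Sum>b<s. \<Sum>c<n. ?c a c)"
    by (intro sum.cong refl) (simp add: sum.delta)
  also have "\<dots> = real s * frob_inner A B"
    using assms by (simp add: frob_inner_def sum_distrib_left)
  finally show ?thesis .
qed

subsection \<open>The Frobenius inner product\<close>

lemma frob_inner_commute:
  assumes "A \<in> carrier_mat m n" "B \<in> carrier_mat m n"
  shows "frob_inner A B = frob_inner B A"
  using assms by (simp add: frob_inner_def mult.commute)

lemma frob_inner_add_left:
  assumes "A \<in> carrier_mat m n" "B \<in> carrier_mat m n"
  shows "frob_inner (A + B) C = frob_inner A C + frob_inner B C"
  using assms by (simp add: frob_inner_def sum.distrib distrib_right)

lemma frob_inner_smult_left: "frob_inner (a \<cdot>\<^sub>m A) B = a * frob_inner A B"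
  by (simp add: frob_inner_def sum_distrib_left mult.assoc)

lemma frob_inner_self_nonneg: "0 \<le> frob_inner A A"
  unfolding frob_inner_def by (intro sum_nonneg) simp

lemma frob_inner_self_eq_zero_iff:
  assumes "A \<in> carrier_mat m n"
  shows "frob_inner A A = 0 \<longleftrightarrow> A = 0\<^sub>m m n"
proof
  assume "frob_inner A A = 0"
  then have "\<forall>i<m. \<forall>j<n. A $$ (i, j) = 0"
    using assms by (simp add: frob_inner_def sum_nonneg_eq_0_iff sum_nonneg)
  then show "A = 0\<^sub>m m n" using assms by (intro eq_matI) auto
qed (simp add: frob_inner_def)

subsection \<open>Lifting to a common level\<close>

text \<open>Intended for \<open>level \<mu> A\<close> dividing \<open>N\<close>: the quotient is
  then exact and the result lies in level \<open>N\<close>.\<close>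

definition lift_to :: "rat \<Rightarrow> nat \<Rightarrow> real mat \<Rightarrow> real mat" where
  "lift_to \<mu> N A = kron A (1\<^sub>m (N div level \<mu> A))"

lemma weighted_inner_lift_to:
  "weighted_inner \<mu> A B = (let t = lcm (level \<mu> A) (level \<mu> B)
     in frob_inner (lift_to \<mu> t A) (lift_to \<mu> t B) / real t)"
  by (simp add: weighted_inner_def lift_to_def Let_def)

lemma mat_boxplus_lift_to:
  "mat_boxplus \<mu> A B = (let t = lcm (level \<mu> A) (level \<mu> B) in lift_to \<mu> t A + lift_to \<mu> t B)"
  by (simp add: mat_boxplus_def lift_to_def Let_def)

context
  fixes \<mu> :: rat
  assumes pos: "\<mu> > 0"
begin

text \<open>Positivity of \<open>\<mu>\<close> enters here: it makes the number of rows determine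
  the level of a matrix in \<open>mats \<mu>\<close>.\<close>

lemma ratio_y_pos: "ratio_y \<mu> > 0"
proof -
  obtain p q where pq: "quotient_of \<mu> = (p, q)" by fastforce
  have "q > 0" using quotient_of_denom_pos[OF pq] .
  moreover have "\<mu> = of_int p / of_int q" using quotient_of_div[OF pq] .
  ultimately have "p > 0" using pos by (simp add: zero_less_divide_iff)
  then show ?thesis by (simp add: ratio_y_def pq)
qed

lemma level_eq:
  assumes "A \<in> mat_level \<mu> i" "i \<ge> 1"
  shows "level \<mu> A = i"
  unfolding level_def using assms ratio_y_pos
  by (intro the_equality) (auto simp: mat_level_def)

lemma mem_mats: "A \<in> mats \<mu> \<longleftrightarrow> level \<mu> A \<ge> 1 \<and> A \<in> mat_level \<mu> (level \<mu> A)"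
  using level_eq by (auto simp: mats_def)

lemma mat_level_mats: "A \<in> mat_level \<mu> i \<Longrightarrow> i \<ge> 1 \<Longrightarrow> A \<in> mats \<mu>"
  by (auto simp: mats_def)

lemma add_mat_level: "A \<in> mat_level \<mu> N \<Longrightarrow> B \<in> mat_level \<mu> N \<Longrightarrow> A + B \<in> mat_level \<mu> N"
  by (simp add: mat_level_def)

lemma smult_mat_level: "A \<in> mat_level \<mu> N \<Longrightarrow> a \<cdot>\<^sub>m A \<in> mat_level \<mu> N"
  by (simp add: mat_level_def)

lemma zero_mat_level: "0\<^sub>m (N * ratio_y \<mu>) (N * ratio_x \<mu>) \<in> mat_level \<mu> N"
  by (simp add: mat_level_def)

lemma kron_one_mat_level: "A \<in> mat_level \<mu> i \<Longrightarrow> kron A (1\<^sub>m s) \<in> mat_level \<mu> (i * s)"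
  by (auto simp: mat_level_def ac_simps intro!: carrier_matI)

lemma level_kron_one:
  assumes "A \<in> mats \<mu>" "s \<ge> 1"
  shows "level \<mu> (kron A (1\<^sub>m s)) = level \<mu> A * s"
  using assms by (intro level_eq kron_one_mat_level) (auto simp: mem_mats Suc_le_eq)

lemma lift_to_mat_level:
  assumes "A \<in> mats \<mu>" "level \<mu> A dvd N"
  shows "lift_to \<mu> N A \<in> mat_level \<mu> N"
  using kron_one_mat_level[of A "level \<mu> A" "N div level \<mu> A"] assms
  by (auto simp: lift_to_def mem_mats)

lemma lift_to_self: "A \<in> mat_level \<mu> N \<Longrightarrow> N \<ge> 1 \<Longrightarrow> lift_to \<mu> N A = A"
  using kron_one_one by (simp add: lift_to_def level_eq)

text \<open>Lifting is transitive along divisors, since the exact quotients of levels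
  multiply.\<close>

lemma lift_to_lift_to:
  assumes "A \<in> mats \<mu>" "level \<mu> A dvd N" "N dvd M" "N \<ge> 1"
  shows "lift_to \<mu> M (lift_to \<mu> N A) = lift_to \<mu> M A"
proof -
  have "level \<mu> (lift_to \<mu> N A) = N"
    using assms by (intro level_eq lift_to_mat_level)
  moreover have "(N div level \<mu> A) * (M div N) = M div level \<mu> A"
    using assms by (auto elim!: dvdE simp: mem_mats)
  ultimately show ?thesis
    unfolding lift_to_def[of \<mu> M] by (simp add: lift_to_def kron_one_kron_one)
qed

text \<open>The existential relation becomes an equation at any common level. Forward, a further
  tensoring makes the two lifts agree and is then cancelled by injectivity; backward, the two
  lifting factors are the witnesses.\<close>

lemma mat_rel_iff:
  assumes "A \<in> mats \<mu>" "B \<in> mats \<mu>" "level \<mu> A dvd N" "level \<mu> B dvd N" "N \<ge> 1"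
  shows "(A, B) \<in> mat_rel \<mu> \<longleftrightarrow> lift_to \<mu> N A = lift_to \<mu> N B"
proof
  assume "(A, B) \<in> mat_rel \<mu>"
  then obtain s t where st: "s \<ge> 1" "t \<ge> 1" and eq: "kron A (1\<^sub>m s) = kron B (1\<^sub>m t)"
    by (auto simp: mat_rel_def)
  \<comment> \<open>The levels of the two sides of \<open>eq\<close> are compared.\<close>
  have lev: "level \<mu> A * s = level \<mu> B * t"
    using level_kron_one assms(1,2) st eq by metis
  \<comment> \<open>Both sides tensor \<open>A\<close> with the identity of size
    \<open>N * s\<close>, because \<open>(N div level \<mu> A) * level \<mu> A = N\<close>.\<close>
  have A: "kron (lift_to \<mu> N A) (1\<^sub>m (level \<mu> A * s)) = kron (kron A (1\<^sub>m s)) (1\<^sub>m N)"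
    using assms by (simp add: lift_to_def kron_one_kron_one)
      (metis dvd_div_mult_self mult.assoc mult.commute)
  have B: "kron (lift_to \<mu> N B) (1\<^sub>m (level \<mu> B * t)) = kron (kron B (1\<^sub>m t)) (1\<^sub>m N)"
    using assms by (simp add: lift_to_def kron_one_kron_one)
      (metis dvd_div_mult_self mult.assoc mult.commute)
  show "lift_to \<mu> N A = lift_to \<mu> N B"
  proof (rule kron_one_inject)
    show "kron (lift_to \<mu> N A) (1\<^sub>m (level \<mu> A * s)) = kron (lift_to \<mu> N B) (1\<^sub>m (level \<mu> A * s))"
      using A B eq lev by simp
    show "level \<mu> A * s > 0" using assms(1) st by (auto simp: mem_mats)
  qed
next
  assume "lift_to \<mu> N A = lift_to \<mu> N B"
  moreover have "N div level \<mu> A \<ge> 1" "N div level \<mu> B \<ge> 1"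
    using assms by (simp_all add: Suc_le_eq div_greater_zero_iff dvd_imp_le mem_mats)
  ultimately show "(A, B) \<in> mat_rel \<mu>"
    using assms(1,2) unfolding mat_rel_def lift_to_def by blast
qed

text \<open>The lift already lies in level \<open>N\<close>, so lifting it to \<open>N\<close> once
  more changes nothing.\<close>

lemma mat_rel_lift_to:
  assumes "A \<in> mats \<mu>" "level \<mu> A dvd N" "N \<ge> 1"
  shows "(A, lift_to \<mu> N A) \<in> mat_rel \<mu>"
proof -
  have mem: "lift_to \<mu> N A \<in> mat_level \<mu> N" using assms lift_to_mat_level by blast
  show ?thesis
    using assms mem by (subst mat_rel_iff[where N = N])
      (auto simp: level_eq mat_level_mats lift_to_self)
qed

text \<open>For transitivity, the two given relations come with unrelated identity factors; at a
  level common to all three matrices it reduces to transitivity of equality.\<close>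

lemma equiv_mat_rel: "equiv (mats \<mu>) (mat_rel \<mu>)"
proof (rule equivI)
  show "mat_rel \<mu> \<subseteq> mats \<mu> \<times> mats \<mu>" by (auto simp: mat_rel_def)
  show "refl_on (mats \<mu>) (mat_rel \<mu>)"
    by (rule refl_onI) (auto simp: mat_rel_def)
  show "sym (mat_rel \<mu>)"
    by (rule symI) (auto simp: mat_rel_def, metis)
  show "trans (mat_rel \<mu>)"
  proof (rule transI)
    fix A B C assume AB: "(A, B) \<in> mat_rel \<mu>" and BC: "(B, C) \<in> mat_rel \<mu>"
    then have mem: "A \<in> mats \<mu>" "B \<in> mats \<mu>" "C \<in> mats \<mu>" by (auto simp: mat_rel_def)
    define N where "N = level \<mu> A * level \<mu> B * level \<mu> C"
    have N: "level \<mu> A dvd N" "level \<mu> B dvd N" "level \<mu> C dvd N" "N \<ge> 1"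
      using mem by (auto simp: N_def mem_mats Suc_le_eq)
    show "(A, C) \<in> mat_rel \<mu>"
      using AB BC mem N by (simp add: mat_rel_iff[where N = N])
  qed
qed

section \<open>Sum and inner product at an arbitrary common level\<close>

lemma mat_boxplus_level:
  assumes "A \<in> mats \<mu>" "B \<in> mats \<mu>"
  shows "mat_boxplus \<mu> A B \<in> mat_level \<mu> (lcm (level \<mu> A) (level \<mu> B))"
proof -
  let ?t = "lcm (level \<mu> A) (level \<mu> B)"
  have "lift_to \<mu> ?t A \<in> mat_level \<mu> ?t" "lift_to \<mu> ?t B \<in> mat_level \<mu> ?t"
    using assms by (auto intro!: lift_to_mat_level)
  then show ?thesis by (auto simp: mat_boxplus_lift_to Let_def mat_level_def)
qed

text \<open>The least common multiple \<open>t\<close> can be traded for any common multiple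
  \<open>N\<close>, because the passage from level \<open>t\<close> to level \<open>N\<close> is
  additive.\<close>

lemma lift_to_mat_boxplus:
  assumes "A \<in> mats \<mu>" "B \<in> mats \<mu>" "level \<mu> A dvd N" "level \<mu> B dvd N" "N \<ge> 1"
  shows "lift_to \<mu> N (mat_boxplus \<mu> A B) = lift_to \<mu> N A + lift_to \<mu> N B"
proof -
  define t where "t = lcm (level \<mu> A) (level \<mu> B)"
  have t: "t dvd N" "t \<ge> 1" "level \<mu> A dvd t" "level \<mu> B dvd t"
    using assms by (auto simp: t_def mem_mats Suc_le_eq lcm_pos_nat)
  have lev: "lift_to \<mu> t A \<in> mat_level \<mu> t" "lift_to \<mu> t B \<in> mat_level \<mu> t"
    using assms t by (auto intro!: lift_to_mat_level)
  have "level \<mu> (mat_boxplus \<mu> A B) = t"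
    using mat_boxplus_level[OF assms(1,2)] t(2) level_eq by (simp add: t_def)
  then have "lift_to \<mu> N (mat_boxplus \<mu> A B) =
      kron (lift_to \<mu> t A) (1\<^sub>m (N div t)) + kron (lift_to \<mu> t B) (1\<^sub>m (N div t))"
    using lev kron_add_one unfolding lift_to_def[of \<mu> N] mat_level_def
    by (simp add: mat_boxplus_lift_to Let_def flip: t_def)
  also have "\<dots> = lift_to \<mu> N (lift_to \<mu> t A) + lift_to \<mu> N (lift_to \<mu> t B)"
    using lev t(2) by (simp add: lift_to_def[of \<mu> N] level_eq)
  finally show ?thesis using assms t by (simp add: lift_to_lift_to)
qed

text \<open>Passing from \<open>t\<close> to \<open>N\<close> multiplies the Frobenius product by
  \<open>N div t\<close>, which the change of denominator cancels.\<close>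

lemma weighted_inner_eq:
  assumes "A \<in> mats \<mu>" "B \<in> mats \<mu>" "level \<mu> A dvd N" "level \<mu> B dvd N" "N \<ge> 1"
  shows "weighted_inner \<mu> A B = frob_inner (lift_to \<mu> N A) (lift_to \<mu> N B) / real N"
proof -
  define t where "t = lcm (level \<mu> A) (level \<mu> B)"
  have t: "t dvd N" "t \<ge> 1" "level \<mu> A dvd t" "level \<mu> B dvd t"
    using assms by (auto simp: t_def mem_mats Suc_le_eq lcm_pos_nat)
  have lev: "lift_to \<mu> t A \<in> mat_level \<mu> t" "lift_to \<mu> t B \<in> mat_level \<mu> t"
    using assms t by (auto intro!: lift_to_mat_level)
  have "frob_inner (lift_to \<mu> N (lift_to \<mu> t A)) (lift_to \<mu> N (lift_to \<mu> t B)) =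
      real (N div t) * frob_inner (lift_to \<mu> t A) (lift_to \<mu> t B)"
    using lev t(2) frob_inner_kron_one by (simp add: lift_to_def[of \<mu> N] level_eq mat_level_def)
  then have "frob_inner (lift_to \<mu> N A) (lift_to \<mu> N B) =
      real (N div t) * frob_inner (lift_to \<mu> t A) (lift_to \<mu> t B)"
    using assms t by (simp add: lift_to_lift_to)
  moreover have "real N = real (N div t) * real t"
    using t(1) by (simp flip: of_nat_mult)
  ultimately show ?thesis
    using t(2) assms(5) by (auto simp: weighted_inner_lift_to Let_def field_simps simp flip: t_def)
qed

subsection \<open>Operations on classes\<close>

lemma carrier_iff: "X \<in> carrier (Sigma_space \<mu>) \<longleftrightarrow> (\<exists>A\<in>mats \<mu>. X = mat_class \<mu> A)"
  by (auto simp: Sigma_space_def quotient_def mat_class_def)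

lemma mat_class_carrier: "A \<in> mats \<mu> \<Longrightarrow> mat_class \<mu> A \<in> carrier (Sigma_space \<mu>)"
  by (auto simp: carrier_iff)

lemma mem_mat_class: "A \<in> mat_class \<mu> B \<longleftrightarrow> (B, A) \<in> mat_rel \<mu>"
  by (simp add: mat_class_def)

lemma mat_class_self: "A \<in> mats \<mu> \<Longrightarrow> A \<in> mat_class \<mu> A"
  unfolding mat_class_def by (rule equiv_class_self[OF equiv_mat_rel])

lemma mat_class_eq_iff:
  "A \<in> mats \<mu> \<Longrightarrow> B \<in> mats \<mu> \<Longrightarrow> mat_class \<mu> A = mat_class \<mu> B \<longleftrightarrow> (A, B) \<in> mat_rel \<mu>"
  unfolding mat_class_def by (rule eq_equiv_class_iff[OF equiv_mat_rel])

text \<open>Each level embeds injectively into the quotient; definiteness of the inner product rests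
  on this.\<close>

lemma mat_class_eq_iff_same_level:
  assumes "A \<in> mat_level \<mu> N" "B \<in> mat_level \<mu> N" "N \<ge> 1"
  shows "mat_class \<mu> A = mat_class \<mu> B \<longleftrightarrow> A = B"
proof -
  have "A \<in> mats \<mu>" "B \<in> mats \<mu>" using assms mat_level_mats by auto
  then show ?thesis
    using assms mat_rel_iff[of A B N] by (simp add: mat_class_eq_iff level_eq lift_to_self)
qed

text \<open>Three classes are treated at once because no axiom involves more vectors. The product of
  their levels serves as the common one.\<close>

lemma common_level:
  assumes "X \<in> carrier (Sigma_space \<mu>)" "Y \<in> carrier (Sigma_space \<mu>)" "Z \<in> carrier (Sigma_space \<mu>)"
  obtains N A B C where "N \<ge> 1"
    "A \<in> mat_level \<mu> N" "B \<in> mat_level \<mu> N" "C \<in> mat_level \<mu> N"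
    "X = mat_class \<mu> A" "Y = mat_class \<mu> B" "Z = mat_class \<mu> C"
proof -
  from assms obtain A B C where mem: "A \<in> mats \<mu>" "B \<in> mats \<mu>" "C \<in> mats \<mu>"
    and XYZ: "X = mat_class \<mu> A" "Y = mat_class \<mu> B" "Z = mat_class \<mu> C"
    by (auto simp: carrier_iff)
  define N where "N = level \<mu> A * level \<mu> B * level \<mu> C"
  have N: "level \<mu> A dvd N" "level \<mu> B dvd N" "level \<mu> C dvd N" "N \<ge> 1"
    using mem by (auto simp: N_def mem_mats Suc_le_eq)
  have lift: "lift_to \<mu> N D \<in> mat_level \<mu> N \<and> mat_class \<mu> D = mat_class \<mu> (lift_to \<mu> N D)"
    if "D \<in> mats \<mu>" "level \<mu> D dvd N" for D
    using that N(4) lift_to_mat_level mat_rel_lift_to mat_level_mats mat_class_eq_iff by metis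
  show ?thesis
    by (rule that[of N "lift_to \<mu> N A" "lift_to \<mu> N B" "lift_to \<mu> N C"])
      (use lift mem N XYZ in auto)
qed

text \<open>Trades an arbitrary representative for the one chosen in level \<open>N\<close>, once
  both are lifted.\<close>

lemma lift_to_mat_rel:
  assumes "(A, A') \<in> mat_rel \<mu>" "A \<in> mat_level \<mu> N" "N \<ge> 1" "N dvd M" "level \<mu> A' dvd M" "M \<ge> 1"
  shows "lift_to \<mu> M A' = lift_to \<mu> M A"
proof -
  have "A' \<in> mats \<mu>" "A \<in> mats \<mu>" using assms by (auto simp: mat_rel_def)
  then show ?thesis using assms mat_rel_iff[of A A' M] by (simp add: level_eq)
qed

text \<open>Well-definedness of the sum: lifted far enough, either side is the sum of the lifts of
  \<open>A\<close> and \<open>B\<close>.\<close>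

lemma mat_class_mat_boxplus:
  assumes "A \<in> mat_level \<mu> N" "B \<in> mat_level \<mu> N" "N \<ge> 1"
    and "A' \<in> mat_class \<mu> A" "B' \<in> mat_class \<mu> B"
  shows "mat_class \<mu> (mat_boxplus \<mu> A' B') = mat_class \<mu> (A + B)"
proof -
  have A': "(A, A') \<in> mat_rel \<mu>" and B': "(B, B') \<in> mat_rel \<mu>"
    using assms by (simp_all add: mem_mat_class)
  then have mem: "A' \<in> mats \<mu>" "B' \<in> mats \<mu>" by (auto simp: mat_rel_def)
  \<comment> \<open>The first factor is the level of \<open>mat_boxplus \<mu> A' B'\<close>, the
    second that of \<open>A + B\<close>, so both lift to \<open>M\<close>.\<close>
  define M where "M = lcm (level \<mu> A') (level \<mu> B') * N"
  have M: "level \<mu> A' dvd M" "level \<mu> B' dvd M" "N dvd M" "M \<ge> 1"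
    and lcm: "lcm (level \<mu> A') (level \<mu> B') \<ge> 1"
    using mem assms(3) by (auto simp: M_def mem_mats Suc_le_eq lcm_pos_nat)
  have sum: "A + B \<in> mat_level \<mu> N" using assms by (auto simp: mat_level_def)
  have "lift_to \<mu> M (mat_boxplus \<mu> A' B') = lift_to \<mu> M A + lift_to \<mu> M B"
    using lift_to_mat_boxplus[OF mem M(1,2,4)] lift_to_mat_rel[OF A' assms(1,3) M(3,1,4)]
      lift_to_mat_rel[OF B' assms(2,3) M(3,2,4)] by simp
  also have "\<dots> = lift_to \<mu> M (A + B)"
    using level_eq[OF sum assms(3)] level_eq[OF assms(1,3)] level_eq[OF assms(2,3)]
      kron_add_one assms(1,2) by (simp add: lift_to_def mat_level_def)
  finally have eq: "lift_to \<mu> M (mat_boxplus \<mu> A' B') = lift_to \<mu> M (A + B)" .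
  have box: "mat_boxplus \<mu> A' B' \<in> mats \<mu>" "level \<mu> (mat_boxplus \<mu> A' B') dvd M"
    using mat_boxplus_level[OF mem] lcm by (auto simp: mat_level_mats level_eq M_def)
  have "A + B \<in> mats \<mu>" "level \<mu> (A + B) dvd M"
    using sum assms(3) M(3) by (auto simp: mat_level_mats level_eq)
  with box eq M(4) show ?thesis by (simp add: mat_class_eq_iff mat_rel_iff[where N = M])
qed

text \<open>Scaling commutes with tensoring, so the identity factors relating \<open>A\<close> and
  \<open>A'\<close> also relate their multiples.\<close>

lemma mat_class_smult:
  assumes "A \<in> mats \<mu>" "A' \<in> mat_class \<mu> A"
  shows "mat_class \<mu> (a \<cdot>\<^sub>m A') = mat_class \<mu> (a \<cdot>\<^sub>m A)"
proof -
  have smult: "a \<cdot>\<^sub>m B \<in> mats \<mu>" if "B \<in> mats \<mu>" for B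
    using that by (auto simp: mats_def dest: smult_mat_level)
  have rel: "(A, A') \<in> mat_rel \<mu>" using assms by (simp add: mem_mat_class)
  then have "(a \<cdot>\<^sub>m A, a \<cdot>\<^sub>m A') \<in> mat_rel \<mu>"
    using smult by (auto simp: mat_rel_def kron_smult_one) metis
  then show ?thesis
    by (simp add: mat_class_def equiv_class_eq[OF equiv_mat_rel])
qed

text \<open>The union defining the sum is nonempty and all its members coincide, so it collapses to
  a single class.\<close>

lemma add_mat_class:
  assumes "A \<in> mat_level \<mu> N" "B \<in> mat_level \<mu> N" "N \<ge> 1"
  shows "mat_class \<mu> A \<oplus>\<^bsub>Sigma_space \<mu>\<^esub> mat_class \<mu> B = mat_class \<mu> (A + B)"
proof -
  have "A \<in> mat_class \<mu> A" "B \<in> mat_class \<mu> B"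
    using assms mat_level_mats mat_class_self by auto
  then show ?thesis
    using mat_class_mat_boxplus[OF assms] by (auto simp: Sigma_space_def)
qed

lemma smult_mat_class:
  assumes "A \<in> mats \<mu>"
  shows "a \<odot>\<^bsub>Sigma_space \<mu>\<^esub> mat_class \<mu> A = mat_class \<mu> (a \<cdot>\<^sub>m A)"
proof -
  have "(\<Union>A'\<in>mat_class \<mu> A. mat_class \<mu> (a \<cdot>\<^sub>m A')) = mat_class \<mu> (a \<cdot>\<^sub>m A)"
    using mat_class_self[OF assms] mat_class_smult[OF assms] by blast
  then show ?thesis by (simp add: Sigma_space_def)
qed

text \<open>The zero class is defined from level 1; lifting its matrix gives the zero matrix of
  level \<open>N\<close>.\<close>

lemma zero_mat_class:
  assumes "N \<ge> 1"
  shows "\<zero>\<^bsub>Sigma_space \<mu>\<^esub> = mat_class \<mu> (0\<^sub>m (N * ratio_y \<mu>) (N * ratio_x \<mu>))"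
proof -
  let ?Z = "0\<^sub>m (ratio_y \<mu>) (ratio_x \<mu>) :: real mat"
  have Z: "?Z \<in> mat_level \<mu> 1" by (simp add: mat_level_def)
  then have "lift_to \<mu> N ?Z = 0\<^sub>m (N * ratio_y \<mu>) (N * ratio_x \<mu>)"
    by (simp add: lift_to_def level_eq kron_zero_one mult.commute)
  moreover have "(?Z, lift_to \<mu> N ?Z) \<in> mat_rel \<mu>"
    using Z assms mat_level_mats[OF Z] level_eq[OF Z] by (intro mat_rel_lift_to) auto
  ultimately show ?thesis
    by (simp add: Sigma_space_def mat_class_def equiv_class_eq[OF equiv_mat_rel])
qed

section \<open>The inner product on classes\<close>

lemma weighted_inner_mat_class:
  assumes "A \<in> mat_level \<mu> N" "B \<in> mat_level \<mu> N" "N \<ge> 1"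
    and "A' \<in> mat_class \<mu> A" "B' \<in> mat_class \<mu> B"
  shows "weighted_inner \<mu> A' B' = frob_inner A B / real N"
proof -
  have A': "(A, A') \<in> mat_rel \<mu>" and B': "(B, B') \<in> mat_rel \<mu>"
    using assms by (simp_all add: mem_mat_class)
  then have mem: "A' \<in> mats \<mu>" "B' \<in> mats \<mu>" "A \<in> mats \<mu>" "B \<in> mats \<mu>"
    by (auto simp: mat_rel_def)
  define M where "M = level \<mu> A' * level \<mu> B' * N"
  have M: "level \<mu> A' dvd M" "level \<mu> B' dvd M" "N dvd M" "M \<ge> 1"
    using mem assms(3) by (auto simp: M_def mem_mats Suc_le_eq)
  \<comment> \<open>\<open>weighted_inner_eq\<close> serves three times: for the primed pair at
    \<open>M\<close>, for the chosen pair at \<open>M\<close>, and for the chosen pair at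
    \<open>N\<close>, where lifting is the identity.\<close>
  have "weighted_inner \<mu> A' B' = frob_inner (lift_to \<mu> M A) (lift_to \<mu> M B) / real M"
    using weighted_inner_eq[OF mem(1,2) M(1,2,4)] lift_to_mat_rel[OF A' assms(1,3) M(3,1,4)]
      lift_to_mat_rel[OF B' assms(2,3) M(3,2,4)] by simp
  also have "\<dots> = weighted_inner \<mu> A B"
    using weighted_inner_eq[OF mem(3,4), of M] assms M by (simp add: level_eq)
  also have "\<dots> = frob_inner A B / real N"
    using weighted_inner_eq[OF mem(3,4), of N] assms by (simp add: level_eq lift_to_self)
  finally show ?thesis .
qed

text \<open>All representatives give the same value, so \<open>the_elem\<close> is applied to a
  singleton.\<close>

lemma Sigma_inner_mat_class:
  assumes "A \<in> mat_level \<mu> N" "B \<in> mat_level \<mu> N" "N \<ge> 1"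
  shows "Sigma_inner \<mu> (mat_class \<mu> A) (mat_class \<mu> B) = frob_inner A B / real N"
proof -
  have "A \<in> mat_class \<mu> A" "B \<in> mat_class \<mu> B"
    using assms mat_level_mats mat_class_self by auto
  then have "(\<Union>A'\<in>mat_class \<mu> A. \<Union>B'\<in>mat_class \<mu> B. {weighted_inner \<mu> A' B'}) =
      {frob_inner A B / real N}"
    using weighted_inner_mat_class[OF assms] by auto
  then show ?thesis by (simp add: Sigma_inner_def)
qed

text \<open>Both sides equal the scaled Frobenius product of representatives in a common
  level.\<close>

lemma Sigma_inner_eq_weighted_inner:
  assumes "X \<in> carrier (Sigma_space \<mu>)" "Y \<in> carrier (Sigma_space \<mu>)" "A \<in> X" "B \<in> Y"
  shows "Sigma_inner \<mu> X Y = weighted_inner \<mu> A B"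
proof -
  obtain N A0 B0 where "N \<ge> 1" "A0 \<in> mat_level \<mu> N" "B0 \<in> mat_level \<mu> N"
    "X = mat_class \<mu> A0" "Y = mat_class \<mu> B0"
    using common_level[OF assms(1,2,2)] by metis
  then show ?thesis
    using assms Sigma_inner_mat_class weighted_inner_mat_class by metis
qed

section \<open>Vector space and inner product laws\<close>

lemma Sigma_space_laws:
  fixes a b :: real
  defines "V \<equiv> Sigma_space \<mu>"
  assumes X: "X \<in> carrier V" and Y: "Y \<in> carrier V" and Z: "Z \<in> carrier V"
  shows Sigma_add_closed: "X \<oplus>\<^bsub>V\<^esub> Y \<in> carrier V"
    and Sigma_add_assoc: "X \<oplus>\<^bsub>V\<^esub> Y \<oplus>\<^bsub>V\<^esub> Z = X \<oplus>\<^bsub>V\<^esub> (Y \<oplus>\<^bsub>V\<^esub> Z)"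
    and Sigma_add_commute: "X \<oplus>\<^bsub>V\<^esub> Y = Y \<oplus>\<^bsub>V\<^esub> X"
    and Sigma_zero_add: "\<zero>\<^bsub>V\<^esub> \<oplus>\<^bsub>V\<^esub> X = X"
    and Sigma_minus_add: "- 1 \<odot>\<^bsub>V\<^esub> X \<oplus>\<^bsub>V\<^esub> X = \<zero>\<^bsub>V\<^esub>"
    and Sigma_smult_closed: "a \<odot>\<^bsub>V\<^esub> X \<in> carrier V"
    and Sigma_add_smult: "(a + b) \<odot>\<^bsub>V\<^esub> X = a \<odot>\<^bsub>V\<^esub> X \<oplus>\<^bsub>V\<^esub> b \<odot>\<^bsub>V\<^esub> X"
    and Sigma_smult_add: "a \<odot>\<^bsub>V\<^esub> (X \<oplus>\<^bsub>V\<^esub> Y) = a \<odot>\<^bsub>V\<^esub> X \<oplus>\<^bsub>V\<^esub> a \<odot>\<^bsub>V\<^esub> Y"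
    and Sigma_smult_smult: "(a * b) \<odot>\<^bsub>V\<^esub> X = a \<odot>\<^bsub>V\<^esub> (b \<odot>\<^bsub>V\<^esub> X)"
    and Sigma_one_smult: "1 \<odot>\<^bsub>V\<^esub> X = X"
    and Sigma_inner_commute: "Sigma_inner \<mu> X Y = Sigma_inner \<mu> Y X"
    and Sigma_inner_add: "Sigma_inner \<mu> (X \<oplus>\<^bsub>V\<^esub> Y) Z = Sigma_inner \<mu> X Z + Sigma_inner \<mu> Y Z"
    and Sigma_inner_smult: "Sigma_inner \<mu> (a \<odot>\<^bsub>V\<^esub> X) Y = a * Sigma_inner \<mu> X Y"
    and Sigma_inner_nonneg: "0 \<le> Sigma_inner \<mu> X X"
    and Sigma_inner_eq_zero_iff: "Sigma_inner \<mu> X X = 0 \<longleftrightarrow> X = \<zero>\<^bsub>V\<^esub>"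
proof -
  \<comment> \<open>One choice of representatives serves all the laws.\<close>
  obtain N A B C where N: "N \<ge> 1"
    and lev: "A \<in> mat_level \<mu> N" "B \<in> mat_level \<mu> N" "C \<in> mat_level \<mu> N"
    and XYZ: "X = mat_class \<mu> A" "Y = mat_class \<mu> B" "Z = mat_class \<mu> C"
    using common_level X Y Z unfolding V_def by metis
  note carr = lev[unfolded mat_level_def]
  note add = add_mat_class[OF _ _ N] and smult = smult_mat_class[OF mat_level_mats[OF _ N]]
    and zero = zero_mat_class[OF N] and closed = mat_class_carrier[OF mat_level_mats[OF _ N]]
    and inner = Sigma_inner_mat_class[OF _ _ N]
  \<comment> \<open>These rules carry every operation on classes over to matrices of level
    \<open>N\<close>, leaving identities between matrices of one fixed size.\<close>
  note simps = V_def XYZ lev add smult zero closed inner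
    add_mat_level smult_mat_level zero_mat_level
  show "X \<oplus>\<^bsub>V\<^esub> Y \<in> carrier V" "a \<odot>\<^bsub>V\<^esub> X \<in> carrier V"
    by (simp_all add: simps)
  show "X \<oplus>\<^bsub>V\<^esub> Y \<oplus>\<^bsub>V\<^esub> Z = X \<oplus>\<^bsub>V\<^esub> (Y \<oplus>\<^bsub>V\<^esub> Z)"
    using carr by (simp add: simps)
  show "X \<oplus>\<^bsub>V\<^esub> Y = Y \<oplus>\<^bsub>V\<^esub> X"
    using comm_add_mat[OF carr(1,2)] by (simp add: simps)
  show "\<zero>\<^bsub>V\<^esub> \<oplus>\<^bsub>V\<^esub> X = X"
    using carr by (simp add: simps)
  \<comment> \<open>The multiple by -1 supplies the additive inverse.\<close>
  have "- 1 \<cdot>\<^sub>m A + A = 0\<^sub>m (N * ratio_y \<mu>) (N * ratio_x \<mu>)"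
    using carr(1) by (intro eq_matI) auto
  then show "- 1 \<odot>\<^bsub>V\<^esub> X \<oplus>\<^bsub>V\<^esub> X = \<zero>\<^bsub>V\<^esub>"
    by (simp add: simps)
  show "(a + b) \<odot>\<^bsub>V\<^esub> X = a \<odot>\<^bsub>V\<^esub> X \<oplus>\<^bsub>V\<^esub> b \<odot>\<^bsub>V\<^esub> X"
    by (simp add: simps add_smult_distrib_right_mat[OF carr(1)])
  show "a \<odot>\<^bsub>V\<^esub> (X \<oplus>\<^bsub>V\<^esub> Y) = a \<odot>\<^bsub>V\<^esub> X \<oplus>\<^bsub>V\<^esub> a \<odot>\<^bsub>V\<^esub> Y"
    by (simp add: simps add_smult_distrib_left_mat[OF carr(1,2)])
  have "(a * b) \<cdot>\<^sub>m A = a \<cdot>\<^sub>m (b \<cdot>\<^sub>m A)" by (rule eq_matI) auto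
  then show "(a * b) \<odot>\<^bsub>V\<^esub> X = a \<odot>\<^bsub>V\<^esub> (b \<odot>\<^bsub>V\<^esub> X)"
    by (simp add: simps)
  have "1 \<cdot>\<^sub>m A = A" by (rule eq_matI) auto
  then show "1 \<odot>\<^bsub>V\<^esub> X = X"
    by (simp add: simps)
  show "Sigma_inner \<mu> X Y = Sigma_inner \<mu> Y X"
    using frob_inner_commute[OF carr(1,2)] by (simp add: simps)
  show "Sigma_inner \<mu> (X \<oplus>\<^bsub>V\<^esub> Y) Z = Sigma_inner \<mu> X Z + Sigma_inner \<mu> Y Z"
    by (simp add: simps frob_inner_add_left[OF carr(1,2)] add_divide_distrib)
  show "Sigma_inner \<mu> (a \<odot>\<^bsub>V\<^esub> X) Y = a * Sigma_inner \<mu> X Y"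
    by (simp add: simps frob_inner_smult_left)
  show "0 \<le> Sigma_inner \<mu> X X"
    by (simp add: simps frob_inner_self_nonneg)
  show "Sigma_inner \<mu> X X = 0 \<longleftrightarrow> X = \<zero>\<^bsub>V\<^esub>"
    \<comment> \<open>A vanishing value forces \<open>A\<close> to be the zero matrix, the only
      representative of the zero class in level \<open>N\<close>.\<close>
    using N mat_class_eq_iff_same_level[OF lev(1) zero_mat_level N]
      frob_inner_self_eq_zero_iff[OF carr(1)] by (simp add: simps)
qed

section \<open>Assembly of the algebraic structures\<close>

lemma abelian_group_Sigma_space: "abelian_group (Sigma_space \<mu>)"
proof (rule abelian_groupI)
  show "\<zero>\<^bsub>Sigma_space \<mu>\<^esub> \<in> carrier (Sigma_space \<mu>)"
    using mat_class_carrier[OF mat_level_mats[OF zero_mat_level, of 1]] zero_mat_class[of 1] by simp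
  show "\<exists>Y\<in>carrier (Sigma_space \<mu>). Y \<oplus>\<^bsub>Sigma_space \<mu>\<^esub> X = \<zero>\<^bsub>Sigma_space \<mu>\<^esub>"
    if "X \<in> carrier (Sigma_space \<mu>)" for X
    using that Sigma_minus_add Sigma_smult_closed by blast
\<comment> \<open>Each law carries three membership premises; \<open>assumption\<close> instantiates
  vectors left open by the goal with ones known to lie in the carrier.\<close>
qed (rule Sigma_add_closed Sigma_add_assoc Sigma_add_commute Sigma_zero_add; assumption)+

lemma module_Sigma_space: "module (class_ring :: real ring) (Sigma_space \<mu>)"
  by (rule moduleI[OF class_cring.is_cring abelian_group_Sigma_space])
    \<comment> \<open>The record operations of \<open>class_ring\<close> are first rewritten into
      those of the reals, in which the laws are stated.\<close>
    (simp_all only: class_ring_simps,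
      (rule Sigma_smult_closed Sigma_add_smult Sigma_smult_add
        Sigma_smult_smult Sigma_one_smult; assumption)+)

lemma real_inner_product_space_Sigma_space:
  "real_inner_product_space (Sigma_space \<mu>) (Sigma_inner \<mu>)"
  by (intro real_inner_product_space.intro real_inner_product_space_axioms.intro
      vectorspace.intro module_Sigma_space class_field)
    (rule Sigma_inner_commute Sigma_inner_add Sigma_inner_smult
      Sigma_inner_nonneg Sigma_inner_eq_zero_iff; assumption)+

end

theorem theorem84:
  fixes \<mu> :: rat
  assumes "\<mu> > 0"
  shows "real_inner_product_space (Sigma_space \<mu>) (Sigma_inner \<mu>) \<and>
    (\<forall>X\<in>carrier (Sigma_space \<mu>). \<forall>Y\<in>carrier (Sigma_space \<mu>). \<forall>A\<in>X. \<forall>B\<in>Y.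
      Sigma_inner \<mu> X Y = weighted_inner \<mu> A B)"
  using real_inner_product_space_Sigma_space[OF assms] Sigma_inner_eq_weighted_inner[OF assms]
  by blast

end
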